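(* Let $n\ge1$, let $F\colon M\to N$ be a smooth map of manifolds and $\varpi=(\omega,\eta)\in\Omega^{n+1}(F)$. (i) (Target edge.) If $M=\varnothing$, the relative nondegeneracy condition is vacuous: every $d_F$-closed $\varpi$ is relative $n$-plectic. (Thus in this case relative $n$-plectic structures are exactly closed $(n+1)$-forms on $N$, with no nondegeneracy of $\omega$ implied.) (ii) (Source edge.) If $N=\mathrm{pt}$, then $\omega=0$, the closedness condition $d_F\varpi=0$ reduces to $d\eta=0$, and the nondegeneracy condition becomes $\ker\eta=0$. Hence $(F,\varpi)$ is relative $n$-plectic if and only if $(M,\eta)$ is absolutely $(n-1)$-plectic.
   Context: $\Omega^k(F)=\Omega^k(N)\oplus\Omega^{k-1}(M)$ with $d_F(\alpha,\beta)=(d\alpha,F^*\alpha-d\beta)$. $(F,\varpi)$ with $\varpi=(\omega,\eta)\in\Omega^{n+1}(F)$, $d_F\varpi=0$, is relative $n$-plectic if for each $m\in M$ the map $w\mapsto(\iota_{dF(w)}\omega,\iota_w\eta)$ is injective on $T_mM$. A manifold $(P,\rho)$ is (absolutely) $m$-plectic if $\rho\in\Omega^{m+1}(P)$ is closed and nondegenerate, i.e. $\ker\rho:=\{w:\iota_w\rho=0\}$ is zero at every point. *)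

theory Defs
  imports "HOL-Analysis.Analysis"
begin

section \<open>Smooth functions on open subsets of R^d\<close>

text \<open>
  R^d is \<open>Euclidean_space d\<close>, the subspace of \<open>nat \<Rightarrow> real\<close> of all \<open>x\<close> with \<open>x i = 0\<close> for
  \<open>i \<ge> d\<close>. The dimension is a term and may be 0, which the class \<open>euclidean_space\<close> excludes.
  A function matters only on the open set \<open>U\<close> under consideration: the partial derivatives
  at a point of \<open>U\<close> do not see its values elsewhere.
\<close>

definition partial_deriv :: "nat \<Rightarrow> ((nat \<Rightarrow> real) \<Rightarrow> real) \<Rightarrow> (nat \<Rightarrow> real) \<Rightarrow> real" where
  "partial_deriv i f x = deriv (\<lambda>t. f (x(i := t))) (x i)"

primrec Ck_on :: "nat \<Rightarrow> nat \<Rightarrow> (nat \<Rightarrow> real) set \<Rightarrow> ((nat \<Rightarrow> real) \<Rightarrow> real) \<Rightarrow> bool" where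
  "Ck_on d 0 U f \<longleftrightarrow> continuous_map (subtopology (Euclidean_space d) U) euclideanreal f"
| "Ck_on d (Suc k) U f \<longleftrightarrow>
     continuous_map (subtopology (Euclidean_space d) U) euclideanreal f \<and>
     (\<forall>i<d. (\<forall>x\<in>U. (\<lambda>t. f (x(i := t))) differentiable (at (x i))) \<and>
            Ck_on d k U (partial_deriv i f))"

definition smooth_on :: "nat \<Rightarrow> (nat \<Rightarrow> real) set \<Rightarrow> ((nat \<Rightarrow> real) \<Rightarrow> real) \<Rightarrow> bool" where
  "smooth_on d U f \<longleftrightarrow> (\<forall>k. Ck_on d k U f)"

section \<open>Smooth manifolds and smooth maps\<close>

type_synonym 'a chart = "'a set \<times> ('a \<Rightarrow> nat \<Rightarrow> real)"

record 'a mfd =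
  top_of :: "'a topology"
  dim_of :: nat
  atlas_of :: "'a chart set"

abbreviation pts :: "'a mfd \<Rightarrow> 'a set" where
  "pts M \<equiv> topspace (top_of M)"

text \<open>The atlas need not be maximal, and \<open>pts M\<close> may be empty.\<close>

definition smooth_manifold :: "'a mfd \<Rightarrow> bool" where
  "smooth_manifold M \<longleftrightarrow>
     Hausdorff_space (top_of M) \<and> second_countable (top_of M) \<and>
     \<Union> (fst ` atlas_of M) = pts M \<and>
     (\<forall>(U, \<phi>) \<in> atlas_of M.
        openin (top_of M) U \<and> openin (Euclidean_space (dim_of M)) (\<phi> ` U) \<and>
        homeomorphic_map (subtopology (top_of M) U)
          (subtopology (Euclidean_space (dim_of M)) (\<phi> ` U)) \<phi>) \<and>
     (\<forall>(U, \<phi>) \<in> atlas_of M. \<forall>(V, \<psi>) \<in> atlas_of M. \<forall>i < dim_of M.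
        smooth_on (dim_of M) (\<phi> ` (U \<inter> V)) (\<lambda>x. \<psi> (inv_into U \<phi> x) i))"

text \<open>Functions on \<open>M\<close> are represented by functions on the whole type that vanish off \<open>pts M\<close>.\<close>

definition smooth_funs :: "'a mfd \<Rightarrow> ('a \<Rightarrow> real) set" where
  "smooth_funs M =
     {f. (\<forall>x. x \<notin> pts M \<longrightarrow> f x = 0) \<and>
         (\<forall>(U, \<phi>) \<in> atlas_of M. smooth_on (dim_of M) (\<phi> ` U) (\<lambda>x. f (inv_into U \<phi> x)))}"

definition smooth_map :: "'a mfd \<Rightarrow> 'b mfd \<Rightarrow> ('a \<Rightarrow> 'b) \<Rightarrow> bool" where
  "smooth_map M N F \<longleftrightarrow>
     continuous_map (top_of M) (top_of N) F \<and>
     (\<forall>(U, \<phi>) \<in> atlas_of M. \<forall>(V, \<psi>) \<in> atlas_of N. \<forall>i < dim_of N.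
        smooth_on (dim_of M) (\<phi> ` {p \<in> U. F p \<in> V}) (\<lambda>x. \<psi> (F (inv_into U \<phi> x)) i))"

section \<open>Tangent vectors\<close>

text \<open>
  Tangent vectors are derivations of the algebra of smooth functions; they are set to 0 on
  arguments that are not smooth functions, so that equality of tangent vectors is equality
  of derivations.
\<close>

type_synonym 'a tvec = "('a \<Rightarrow> real) \<Rightarrow> real"

definition tangent_space :: "'a mfd \<Rightarrow> 'a \<Rightarrow> 'a tvec set" where
  "tangent_space M p =
     {v. (\<forall>f. f \<notin> smooth_funs M \<longrightarrow> v f = 0) \<and>
         (\<forall>f\<in>smooth_funs M. \<forall>g\<in>smooth_funs M. \<forall>a b.
            v (\<lambda>x. a * f x + b * g x) = a * v f + b * v g) \<and>
         (\<forall>f\<in>smooth_funs M. \<forall>g\<in>smooth_funs M.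
            v (\<lambda>x. f x * g x) = f p * v g + g p * v f)}"

definition tangent_map :: "'a mfd \<Rightarrow> 'b mfd \<Rightarrow> ('a \<Rightarrow> 'b) \<Rightarrow> 'a tvec \<Rightarrow> 'b tvec" where
  "tangent_map M N F v =
     (\<lambda>f. if f \<in> smooth_funs N then v (\<lambda>x. if x \<in> pts M then f (F x) else 0) else 0)"

text \<open>
  \<open>coord_vec M (U, \<phi>) a p\<close> is the sum of all \<open>a i * \<partial>/\<partial>x_i\<close> at \<open>p \<in> U\<close>, where
  \<open>x_i\<close> are the coordinates of the chart, and \<open>components\<close> recovers \<open>a\<close> from that vector.
\<close>

definition coord_vec :: "'a mfd \<Rightarrow> 'a chart \<Rightarrow> (nat \<Rightarrow> real) \<Rightarrow> 'a \<Rightarrow> 'a tvec" where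
  "coord_vec M c a p =
     (\<lambda>f. if f \<in> smooth_funs M
           then \<Sum>i<dim_of M. a i * partial_deriv i (\<lambda>x. f (inv_into (fst c) (snd c) x)) (snd c p)
           else 0)"

definition unit_vec :: "nat \<Rightarrow> nat \<Rightarrow> real" where
  "unit_vec i = (\<lambda>j. if j = i then 1 else 0)"

definition components :: "'a mfd \<Rightarrow> 'a chart \<Rightarrow> 'a \<Rightarrow> 'a tvec \<Rightarrow> nat \<Rightarrow> real" where
  "components M c p v =
     (THE a. a \<in> topspace (Euclidean_space (dim_of M)) \<and> v = coord_vec M c a p)"

section \<open>Differential forms\<close>

text \<open>
  The value of a \<open>k\<close>-form at \<open>p\<close> takes a list of \<open>k\<close> tangent vectors at \<open>p\<close>. On all other
  arguments it is 0, so that equality of forms is equality of functions.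
\<close>

type_synonym 'a dform = "'a \<Rightarrow> 'a tvec list \<Rightarrow> real"

definition zero_form :: "'a dform" where
  "zero_form = (\<lambda>p vs. 0)"

definition forms :: "'a mfd \<Rightarrow> nat \<Rightarrow> 'a dform set" where
  "forms M k =
     {\<omega>. (\<forall>p vs. \<not> (p \<in> pts M \<and> length vs = k \<and> set vs \<subseteq> tangent_space M p) \<longrightarrow> \<omega> p vs = 0) \<and>
         (\<forall>p\<in>pts M. \<forall>vs. length vs = k \<and> set vs \<subseteq> tangent_space M p \<longrightarrow>
            (\<forall>i<k. \<forall>v\<in>tangent_space M p. \<forall>w\<in>tangent_space M p. \<forall>a b.
               \<omega> p (vs[i := (\<lambda>f. a * v f + b * w f)]) =
                 a * \<omega> p (vs[i := v]) + b * \<omega> p (vs[i := w])) \<and>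
            (\<forall>i j. i < j \<and> j < k \<and> vs ! i = vs ! j \<longrightarrow> \<omega> p vs = 0)) \<and>
         (\<forall>(U, \<phi>) \<in> atlas_of M. \<forall>is. length is = k \<and> set is \<subseteq> {..<dim_of M} \<longrightarrow>
            smooth_on (dim_of M) (\<phi> ` U)
              (\<lambda>x. \<omega> (inv_into U \<phi> x)
                 (map (\<lambda>i. coord_vec M (U, \<phi>) (unit_vec i) (inv_into U \<phi> x)) is)))}"

text \<open>
  Exterior derivative, computed in a chart around \<open>p\<close>: the arguments are extended to vector
  fields with constant coefficients in the chart, whose brackets vanish, so that the invariant
  formula reduces to the sum over \<open>j\<close> of \<open>(-1)^j\<close> times the derivative in direction \<open>v_j\<close> of
  \<open>\<omega>(v_0, ..., v_(j-1), v_(j+1), ..., v_k)\<close>. The result does not depend on the chart chosen.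
  The degree is not a parameter, since a \<open>k\<close>-form vanishes on lists of length other than \<open>k\<close>.
\<close>

definition ext_deriv :: "'a mfd \<Rightarrow> 'a dform \<Rightarrow> 'a dform" where
  "ext_deriv M \<omega> =
     (\<lambda>p vs.
        if p \<in> pts M \<and> set vs \<subseteq> tangent_space M p then
          let c = (SOME c. c \<in> atlas_of M \<and> p \<in> fst c);
              as = map (components M c p) vs
          in \<Sum>j<length vs. (-1) ^ j *
               (\<Sum>i<dim_of M. (as ! j) i *
                  partial_deriv i
                    (\<lambda>x. let q = inv_into (fst c) (snd c) x
                         in \<omega> q (map (\<lambda>a. coord_vec M c a q) (take j as @ drop (Suc j) as)))
                    (snd c p))
        else 0)"

definition pullback :: "'a mfd \<Rightarrow> 'b mfd \<Rightarrow> ('a \<Rightarrow> 'b) \<Rightarrow> 'b dform \<Rightarrow> 'a dform" where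
  "pullback M N F \<omega> =
     (\<lambda>p vs. if p \<in> pts M \<and> set vs \<subseteq> tangent_space M p
             then \<omega> (F p) (map (tangent_map M N F) vs) else 0)"

definition contraction :: "'a tvec \<Rightarrow> ('a tvec list \<Rightarrow> real) \<Rightarrow> 'a tvec list \<Rightarrow> real" where
  "contraction w \<alpha> = (\<lambda>vs. \<alpha> (w # vs))"

section \<open>Absolute and relative plectic structures\<close>

definition form_kernel :: "'a mfd \<Rightarrow> 'a dform \<Rightarrow> 'a \<Rightarrow> 'a tvec set" where
  "form_kernel M \<rho> p = {w \<in> tangent_space M p. contraction w (\<rho> p) = (\<lambda>vs. 0)}"

definition nondegenerate :: "'a mfd \<Rightarrow> 'a dform \<Rightarrow> bool" where
  "nondegenerate M \<rho> \<longleftrightarrow> (\<forall>p\<in>pts M. form_kernel M \<rho> p = {\<lambda>f. 0})"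

definition plectic :: "nat \<Rightarrow> 'a mfd \<Rightarrow> 'a dform \<Rightarrow> bool" where
  "plectic m P \<rho> \<longleftrightarrow> \<rho> \<in> forms P (Suc m) \<and> ext_deriv P \<rho> = zero_form \<and> nondegenerate P \<rho>"

text \<open>For \<open>F: M \<rightarrow> N\<close>, the space of relative \<open>k\<close>-forms depends on \<open>F\<close> only through \<open>M\<close> and \<open>N\<close>.\<close>

definition rel_forms :: "'a mfd \<Rightarrow> 'b mfd \<Rightarrow> nat \<Rightarrow> ('b dform \<times> 'a dform) set" where
  "rel_forms M N k = forms N k \<times> (case k of 0 \<Rightarrow> {zero_form} | Suc l \<Rightarrow> forms M l)"

definition rel_deriv ::
  "'a mfd \<Rightarrow> 'b mfd \<Rightarrow> ('a \<Rightarrow> 'b) \<Rightarrow> 'b dform \<times> 'a dform \<Rightarrow> 'b dform \<times> 'a dform" where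
  "rel_deriv M N F = (\<lambda>(\<alpha>, \<beta>).
     (ext_deriv N \<alpha>, \<lambda>p vs. pullback M N F \<alpha> p vs - ext_deriv M \<beta> p vs))"

definition rel_closed ::
  "'a mfd \<Rightarrow> 'b mfd \<Rightarrow> ('a \<Rightarrow> 'b) \<Rightarrow> 'b dform \<times> 'a dform \<Rightarrow> bool" where
  "rel_closed M N F \<sigma> \<longleftrightarrow> rel_deriv M N F \<sigma> = (zero_form, zero_form)"

definition rel_nondegenerate_at ::
  "'a mfd \<Rightarrow> 'b mfd \<Rightarrow> ('a \<Rightarrow> 'b) \<Rightarrow> 'b dform \<times> 'a dform \<Rightarrow> 'a \<Rightarrow> bool" where
  "rel_nondegenerate_at M N F = (\<lambda>(\<omega>, \<eta>) m.
     inj_on (\<lambda>w. (contraction (tangent_map M N F w) (\<omega> (F m)), contraction w (\<eta> m)))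
       (tangent_space M m))"

definition rel_nondegenerate ::
  "'a mfd \<Rightarrow> 'b mfd \<Rightarrow> ('a \<Rightarrow> 'b) \<Rightarrow> 'b dform \<times> 'a dform \<Rightarrow> bool" where
  "rel_nondegenerate M N F \<sigma> \<longleftrightarrow> (\<forall>m\<in>pts M. rel_nondegenerate_at M N F \<sigma> m)"

definition rel_plectic ::
  "nat \<Rightarrow> 'a mfd \<Rightarrow> 'b mfd \<Rightarrow> ('a \<Rightarrow> 'b) \<Rightarrow> 'b dform \<times> 'a dform \<Rightarrow> bool" where
  "rel_plectic n M N F \<sigma> \<longleftrightarrow>
     \<sigma> \<in> rel_forms M N (Suc n) \<and> rel_closed M N F \<sigma> \<and> rel_nondegenerate M N F \<sigma>"

end

theory Submission
  imports Defs
begin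

text \<open>
  Over an empty \<open>M\<close> the only form is the zero form and nondegeneracy quantifies over no points,
  so a relative plectic structure is just a closed form \<open>\<alpha>\<close> on \<open>N\<close>. That such an \<open>\<alpha>\<close> need
  not be nondegenerate is witnessed by \<open>\<alpha> = 0\<close>, whose kernel is the whole tangent space.

  When \<open>N\<close> is a point, its only tangent vector is zero (\<open>tangent_space_singleton\<close>): a smooth
  function \<open>f\<close> with value \<open>c\<close> satisfies \<open>f\<^sup>2 = c f\<close>, and the Leibniz rule turns this into
  \<open>2 c v(f) = c v(f)\<close>. By multilinearity all forms of positive degree on \<open>N\<close> vanish, so
  \<open>\<omega> = 0\<close>, the closedness condition loses its pullback term, and the map whose injectivity
  defines relative nondegeneracy has a constant first component. The second component is linear
  in the tangent vector, so that its injectivity is triviality of \<open>ker \<eta>\<close>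
  (\<open>inj_on_contraction_iff\<close>).
\<close>

section \<open>The zero form\<close>

lemma Ck_on_zero: "Ck_on d k U (\<lambda>x. 0)"
  by (induction k) (simp_all add: partial_deriv_def [abs_def])

lemma smooth_on_zero: "smooth_on d U (\<lambda>x. 0)"
  by (simp add: smooth_on_def Ck_on_zero)

lemma zero_form_in_forms: "zero_form \<in> forms M k"
  by (auto simp: forms_def zero_form_def smooth_on_zero)

lemma ext_deriv_zero_form: "ext_deriv M zero_form = zero_form"
  by (simp add: ext_deriv_def zero_form_def partial_deriv_def Let_def fun_eq_iff)

lemma form_kernel_zero_form: "form_kernel M zero_form p = tangent_space M p"
  by (simp add: form_kernel_def contraction_def zero_form_def)

lemma rel_closed_zero_iff:
  "rel_closed M N F (zero_form, \<eta>) \<longleftrightarrow> ext_deriv M \<eta> = zero_form"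
proof -
  have "pullback M N F zero_form p vs = 0" for p vs
    by (simp add: pullback_def zero_form_def)
  then have "rel_closed M N F (zero_form, \<eta>) \<longleftrightarrow>
      (\<lambda>p vs. - ext_deriv M \<eta> p vs) = zero_form"
    by (simp add: rel_closed_def rel_deriv_def ext_deriv_zero_form)
  also have "\<dots> \<longleftrightarrow> ext_deriv M \<eta> = zero_form"
    unfolding zero_form_def fun_eq_iff neg_equal_0_iff_equal by (rule refl)
  finally show ?thesis .
qed

section \<open>Linearity in the first argument\<close>

lemma tangent_space_combination:
  assumes "v \<in> tangent_space M p" "w \<in> tangent_space M p"
  shows "(\<lambda>f. a * v f + b * w f) \<in> tangent_space M p"
  using assms unfolding tangent_space_def by (auto simp: algebra_simps)

lemma zero_in_tangent_space: "(\<lambda>f. 0) \<in> tangent_space M p"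
  by (simp add: tangent_space_def)

lemma form_outside:
  assumes "\<omega> \<in> forms M k" "\<not> (p \<in> pts M \<and> length vs = k \<and> set vs \<subseteq> tangent_space M p)"
  shows "\<omega> p vs = 0"
  using assms(1) [unfolded forms_def mem_Collect_eq, THEN conjunct1, THEN spec, THEN spec,
      THEN mp, OF assms(2)] .

text \<open>
  Linearity holds at every point \<open>p\<close> and tail \<open>us\<close> of the type, because a form is zero outside
  its domain and exchanging one tangent vector at \<open>p\<close> for another does not move a list into
  or out of the domain.
\<close>

lemma form_Cons_linear:
  assumes \<omega>: "\<omega> \<in> forms M (Suc k)"
    and v: "v \<in> tangent_space M p" and w: "w \<in> tangent_space M p"
  shows "\<omega> p ((\<lambda>f. a * v f + b * w f) # us) = a * \<omega> p (v # us) + b * \<omega> p (w # us)"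
proof (cases "p \<in> pts M \<and> length us = k \<and> set us \<subseteq> tangent_space M p")
  case True
  then have p: "p \<in> pts M"
    and vus: "length (v # us) = Suc k \<and> set (v # us) \<subseteq> tangent_space M p"
    using v by auto
  from \<omega> [unfolded forms_def mem_Collect_eq, THEN conjunct2, THEN conjunct1, THEN bspec,
      OF p, THEN spec, THEN mp, OF vus, THEN conjunct1, rule_format, of 0 v w a b] v w
  show ?thesis by simp
next
  case False
  then have "\<omega> p (x # us) = 0" for x
    by (intro form_outside [OF \<omega>]) auto
  then show ?thesis by simp
qed

lemma form_Cons_zero:
  assumes "\<omega> \<in> forms M (Suc k)"
  shows "\<omega> p ((\<lambda>f. 0) # us) = 0"
  using form_Cons_linear [OF assms zero_in_tangent_space zero_in_tangent_space, of p 0 0 us]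
  by simp

text \<open>
  Contraction is linear in the contracted vector, so that the difference of two vectors with
  equal contractions lies in the kernel.
\<close>

lemma inj_on_contraction_iff:
  assumes \<eta>: "\<eta> \<in> forms M (Suc k)"
  shows "inj_on (\<lambda>w. contraction w (\<eta> p)) (tangent_space M p) \<longleftrightarrow>
         form_kernel M \<eta> p = {\<lambda>f. 0}"
proof
  have zero: "contraction (\<lambda>f. 0) (\<eta> p) = (\<lambda>vs. 0)"
    by (simp add: contraction_def form_Cons_zero [OF \<eta>])
  assume inj: "inj_on (\<lambda>w. contraction w (\<eta> p)) (tangent_space M p)"
  have "w = (\<lambda>f. 0)" if "w \<in> form_kernel M \<eta> p" for w
  proof (rule inj_onD [OF inj _ _ zero_in_tangent_space])
    show "contraction w (\<eta> p) = contraction (\<lambda>f. 0) (\<eta> p)" "w \<in> tangent_space M p"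
      using that unfolding form_kernel_def zero by blast+
  qed
  moreover have "(\<lambda>f. 0) \<in> form_kernel M \<eta> p"
    unfolding form_kernel_def by (intro CollectI conjI zero_in_tangent_space zero)
  ultimately show "form_kernel M \<eta> p = {\<lambda>f. 0}"
    by blast
next
  assume ker: "form_kernel M \<eta> p = {\<lambda>f. 0}"
  show "inj_on (\<lambda>w. contraction w (\<eta> p)) (tangent_space M p)"
  proof (rule inj_onI)
    fix v w
    assume v: "v \<in> tangent_space M p" and w: "w \<in> tangent_space M p"
      and eq: "contraction v (\<eta> p) = contraction w (\<eta> p)"
    have "contraction (\<lambda>f. 1 * v f + (-1) * w f) (\<eta> p) = (\<lambda>vs. 0)"
    proof
      fix us
      have "\<eta> p (v # us) = \<eta> p (w # us)"
        using fun_cong [OF eq, of us] by (simp add: contraction_def)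
      then show "contraction (\<lambda>f. 1 * v f + (-1) * w f) (\<eta> p) us = 0"
        unfolding contraction_def form_Cons_linear [OF \<eta> v w] by simp
    qed
    then have "(\<lambda>f. 1 * v f + (-1) * w f) \<in> form_kernel M \<eta> p"
      unfolding form_kernel_def by (intro CollectI conjI tangent_space_combination v w)
    then have "(\<lambda>f. 1 * v f + (-1) * w f) = (\<lambda>f. 0)"
      using ker by blast
    then show "v = w"
      by (simp add: fun_eq_iff)
  qed
qed

section \<open>Forms on the empty manifold and on a point\<close>

lemma forms_empty:
  assumes "pts M = {}"
  shows "forms M k = {zero_form}"
proof -
  have "\<omega> = zero_form" if "\<omega> \<in> forms M k" for \<omega>
    using form_outside [OF that] assms by (simp add: zero_form_def fun_eq_iff)
  then show ?thesis
    using zero_form_in_forms by blast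
qed

lemma rel_nondegenerate_empty: "pts M = {} \<Longrightarrow> rel_nondegenerate M N F \<sigma>"
  by (simp add: rel_nondegenerate_def)

lemma rel_closed_empty_iff:
  assumes "pts M = {}"
  shows "rel_closed M N F (\<alpha>, \<beta>) \<longleftrightarrow> ext_deriv N \<alpha> = zero_form"
  using assms
  by (simp add: rel_closed_def rel_deriv_def pullback_def ext_deriv_def [of M] zero_form_def)

lemma rel_plectic_empty_iff:
  assumes "pts M = {}" "n \<ge> 1"
  shows "rel_plectic n M N F (\<alpha>, \<beta>) \<longleftrightarrow>
         \<alpha> \<in> forms N (n + 1) \<and> ext_deriv N \<alpha> = zero_form \<and> \<beta> = zero_form"
  using assms
  by (auto simp: rel_plectic_def rel_forms_def rel_nondegenerate_empty rel_closed_empty_iff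
      forms_empty)

text \<open>
  The argument is algebraic, with no recourse to charts: on a point, \<open>f\<^sup>2\<close> is the multiple
  \<open>f(q) f\<close>, and a derivation evaluates it by the Leibniz rule and by linearity. This settles
  \<open>f(q) \<noteq> 0\<close>; otherwise \<open>f\<close> is the zero function, since it vanishes off \<open>q\<close> by convention.
\<close>

lemma tangent_space_singleton:
  assumes "pts N = {q}"
  shows "tangent_space N q = {\<lambda>f. 0}"
proof -
  have *: "v f = 0" if v: "v \<in> tangent_space N q" for v f
  proof (cases "f \<in> smooth_funs N")
    case True
    have lin: "v (\<lambda>x. a * f x + b * f x) = a * v f + b * v f" for a b
      using v [unfolded tangent_space_def mem_Collect_eq, THEN conjunct2, THEN conjunct1,
          THEN bspec, OF True, THEN bspec, OF True] by (elim allE)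
    have leibniz: "v (\<lambda>x. f x * f x) = f q * v f + f q * v f"
      using v [unfolded tangent_space_def mem_Collect_eq, THEN conjunct2, THEN conjunct2,
          THEN bspec, OF True, THEN bspec, OF True] .
    have off: "f x = 0" if "x \<noteq> q" for x
      using True [unfolded smooth_funs_def mem_Collect_eq, THEN conjunct1, THEN spec, of x]
        that assms by simp
    have "(\<lambda>x. f x * f x) = (\<lambda>x. f q * f x + 0 * f x)"
    proof
      fix x show "f x * f x = f q * f x + 0 * f x"
        using off [of x] by (cases "x = q") simp_all
    qed
    then have "v (\<lambda>x. f x * f x) = v (\<lambda>x. f q * f x + 0 * f x)"
      by (rule arg_cong)
    then have "f q * v f + f q * v f = f q * v f + 0 * v f"
      unfolding leibniz lin .
    then have "f q * v f = 0"
      by linarith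
    moreover have "v f = 0" if "f q = 0"
    proof -
      have "f x = 0 * f x + 0 * f x" for x
        using off [of x] that by (cases "x = q") simp_all
      then have "f = (\<lambda>x. 0 * f x + 0 * f x)"
        by (rule ext)
      then have "v f = v (\<lambda>x. 0 * f x + 0 * f x)"
        by (rule arg_cong)
      also have "\<dots> = 0"
        unfolding lin by simp
      finally show ?thesis .
    qed
    ultimately show ?thesis by auto
  next
    case False
    then show ?thesis
      by (rule v [unfolded tangent_space_def mem_Collect_eq, THEN conjunct1, THEN spec,
          THEN mp])
  qed
  show ?thesis
  proof (intro equalityI subsetI)
    fix v assume "v \<in> tangent_space N q"
    from * [OF this] have "v = (\<lambda>f. 0)"
      by (rule ext)
    then show "v \<in> {\<lambda>f. 0}"
      by (rule ssubst) (rule singletonI)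
  next
    fix v :: "'a tvec" assume "v \<in> {\<lambda>f. 0}"
    then have "v = (\<lambda>f. 0)"
      by (rule singletonD)
    then show "v \<in> tangent_space N q"
      by (rule ssubst) (rule zero_in_tangent_space)
  qed
qed

lemma forms_singleton:
  assumes N: "pts N = {q}" and \<omega>: "\<omega> \<in> forms N (Suc k)"
  shows "\<omega> = zero_form"
proof -
  have "\<omega> p vs = 0" for p vs
  proof (cases "p \<in> pts N \<and> length vs = Suc k \<and> set vs \<subseteq> tangent_space N p")
    case True
    then obtain v us where "vs = v # us"
      by (cases vs) auto
    moreover from this have "v = (\<lambda>f. 0)"
      using True N tangent_space_singleton [OF N] by auto
    ultimately show ?thesis
      by (simp add: form_Cons_zero [OF \<omega>])
  next
    case False
    then show ?thesis by (rule form_outside [OF \<omega>])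
  qed
  then show ?thesis by (simp add: zero_form_def fun_eq_iff)
qed

lemma rel_nondegenerate_at_zero_iff:
  assumes "\<eta> \<in> forms M (Suc k)"
  shows "rel_nondegenerate_at M N F (zero_form, \<eta>) m \<longleftrightarrow> form_kernel M \<eta> m = {\<lambda>f. 0}"
proof -
  have "contraction u (zero_form p) = (\<lambda>vs. 0)" for u :: "'b tvec" and p
    by (simp add: contraction_def zero_form_def)
  then have "rel_nondegenerate_at M N F (zero_form, \<eta>) m \<longleftrightarrow>
      inj_on (\<lambda>w. contraction w (\<eta> m)) (tangent_space M m)"
    by (simp add: rel_nondegenerate_at_def inj_on_def)
  then show ?thesis
    by (simp add: inj_on_contraction_iff [OF assms])
qed

section \<open>Empty source and one-point target\<close>

theorem propositionA4:
  fixes M :: "'a mfd" and N :: "'b mfd" and F :: "'a \<Rightarrow> 'b" and n :: nat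
    and \<omega> :: "'b dform" and \<eta> :: "'a dform"
  assumes "n \<ge> 1"
    and "smooth_manifold M" and "smooth_manifold N" and "smooth_map M N F"
    and "(\<omega>, \<eta>) \<in> rel_forms M N (n + 1)"
  shows "(pts M = {} \<longrightarrow>
           rel_nondegenerate M N F (\<omega>, \<eta>) \<and>
           (rel_closed M N F (\<omega>, \<eta>) \<longrightarrow> rel_plectic n M N F (\<omega>, \<eta>)) \<and>
           {\<sigma>. rel_plectic n M N F \<sigma>} =
             {\<alpha> \<in> forms N (n + 1). ext_deriv N \<alpha> = zero_form} \<times> {zero_form} \<and>
           ((\<exists>q\<in>pts N. tangent_space N q \<noteq> {\<lambda>f. 0}) \<longrightarrow>
              (\<exists>\<alpha>. rel_plectic n M N F (\<alpha>, zero_form) \<and> \<not> nondegenerate N \<alpha>))) \<and>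
         ((\<exists>q. pts N = {q}) \<longrightarrow>
           \<omega> = zero_form \<and>
           (rel_closed M N F (\<omega>, \<eta>) \<longleftrightarrow> ext_deriv M \<eta> = zero_form) \<and>
           (\<forall>m\<in>pts M. rel_nondegenerate_at M N F (\<omega>, \<eta>) m \<longleftrightarrow>
                         form_kernel M \<eta> m = {\<lambda>f. 0}) \<and>
           (rel_plectic n M N F (\<omega>, \<eta>) \<longleftrightarrow> plectic (n - 1) M \<eta>))"
proof (intro conjI impI)
  assume empty: "pts M = {}"
  show "rel_nondegenerate M N F (\<omega>, \<eta>)"
    by (rule rel_nondegenerate_empty [OF empty])
  then show "rel_plectic n M N F (\<omega>, \<eta>)" if "rel_closed M N F (\<omega>, \<eta>)"
    using that assms(5) by (simp add: rel_plectic_def)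
  show "{\<sigma>. rel_plectic n M N F \<sigma>} =
      {\<alpha> \<in> forms N (n + 1). ext_deriv N \<alpha> = zero_form} \<times> {zero_form}"
    using rel_plectic_empty_iff [OF empty assms(1)] by auto
  show "\<exists>\<alpha>. rel_plectic n M N F (\<alpha>, zero_form) \<and> \<not> nondegenerate N \<alpha>"
    if "\<exists>q\<in>pts N. tangent_space N q \<noteq> {\<lambda>f. 0}"
  proof (intro exI conjI)
    show "rel_plectic n M N F (zero_form, zero_form)"
      by (simp add: rel_plectic_empty_iff [OF empty assms(1)] zero_form_in_forms
          ext_deriv_zero_form)
    show "\<not> nondegenerate N zero_form"
      using that by (simp add: nondegenerate_def form_kernel_zero_form)
  qed
next
  assume "\<exists>q. pts N = {q}"
  then obtain q where q: "pts N = {q}" by blast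
  obtain k where n: "n = Suc k"
    using assms(1) by (cases n) auto
  have \<omega>: "\<omega> \<in> forms N (Suc n)" and \<eta>: "\<eta> \<in> forms M (Suc k)"
    using assms(5) by (auto simp: rel_forms_def n)
  show \<omega>0: "\<omega> = zero_form"
    by (rule forms_singleton [OF q \<omega>])
  show closed: "rel_closed M N F (\<omega>, \<eta>) \<longleftrightarrow> ext_deriv M \<eta> = zero_form"
    unfolding \<omega>0 by (rule rel_closed_zero_iff)
  show nondeg: "\<forall>m\<in>pts M. rel_nondegenerate_at M N F (\<omega>, \<eta>) m \<longleftrightarrow>
      form_kernel M \<eta> m = {\<lambda>f. 0}"
    unfolding \<omega>0 by (simp add: rel_nondegenerate_at_zero_iff [OF \<eta>])
  show "rel_plectic n M N F (\<omega>, \<eta>) \<longleftrightarrow> plectic (n - 1) M \<eta>"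
    using assms(5) \<eta> closed nondeg
    by (simp add: rel_plectic_def plectic_def rel_nondegenerate_def nondegenerate_def n)
qed

end
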